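(* Let $n\geq 1$ and let $\theta$ be a reflexive and transitive binary relation on $\{1,2,\ldots,n\}$. Let $R$ be a PI-ring (i.e. a PI-algebra over $\mathbb{Z}$). If $A\in M_{n}(\theta,R)$ and $A$ is invertible in $M_{n}(R)$, then $A^{-1}$ is in $M_{n}(\theta,R)$.
   Context: All rings are associative with identity (not necessarily commutative). $M_n(R)$ is the ring of $n\times n$ matrices over $R$. For a reflexive and transitive relation $\theta$ on $\{1,\ldots,n\}$, the structural matrix ring is the subring $M_{n}(\theta,R)=\{[a_{i,j}]\in M_{n}(R)\mid a_{i,j}=0\text{ if }(i,j)\notin\theta\}$ of $M_n(R)$. A PI-ring is a ring satisfying a polynomial identity $f=0$, where $f$ is a polynomial in noncommuting variables with integer coefficients, at least one of whose monomials of highest degree has coefficient $1$. *)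

theory Defs
  imports
    "HOL-Algebra.Ring"
    "HOL-Library.Poly_Mapping"
    "Jordan_Normal_Form.Matrix"
begin

text \<open>
  Rings are associative with identity, not necessarily commutative, and may be trivial.
  The class \<^class>\<open>ring_1\<close> (on which \<^const>\<open>of_int\<close> and \<^const>\<open>ring_mat\<close> rest) imposes
  \<open>0 \<noteq> 1\<close>, so the sort \<open>{ring, monoid_mult}\<close> is used instead, and the two notions
  are restated for it.
\<close>

definition int_scale :: "int \<Rightarrow> 'a::ab_group_add \<Rightarrow> 'a" where
  "int_scale k a = (\<Sum>i<nat k. a) - (\<Sum>i<nat (- k). a)"

lemma int_scale_eq_of_int_mult: "int_scale k a = of_int k * (a :: 'a::ring_1)"
proof (cases "k \<ge> 0")
  case True
  then show ?thesis by (simp add: int_scale_def)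
next
  case False
  then have "(of_nat (nat (- k)) :: 'a) = - of_int k" by (simp add: of_nat_nat)
  with False show ?thesis by (simp add: int_scale_def)
qed

text \<open>
  A polynomial with integer coefficients in the noncommuting variables \<open>x\<^sub>0, x\<^sub>1, \<dots>\<close>:
  the word \<open>[i\<^sub>1, \<dots>, i\<^sub>d]\<close> stands for the monomial \<open>x\<^bsub>i\<^sub>1\<^esub> \<cdots> x\<^bsub>i\<^sub>d\<^esub>\<close> of degree \<open>d\<close>.
\<close>

type_synonym nc_poly = "nat list \<Rightarrow>\<^sub>0 int"

definition nc_eval :: "(nat \<Rightarrow> 'a::{ring, monoid_mult}) \<Rightarrow> nc_poly \<Rightarrow> 'a" where
  "nc_eval x f = (\<Sum>w\<in>Poly_Mapping.keys f.
     int_scale (Poly_Mapping.lookup f w) (prod_list (map x w)))"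

definition PI_ring :: "'a::{ring, monoid_mult} itself \<Rightarrow> bool" where
  "PI_ring _ \<longleftrightarrow> (\<exists>f :: nc_poly.
     (\<exists>w\<in>Poly_Mapping.keys f. Poly_Mapping.lookup f w = 1 \<and>
        (\<forall>v\<in>Poly_Mapping.keys f. length v \<le> length w)) \<and>
     (\<forall>x :: nat \<Rightarrow> 'a. nc_eval x f = 0))"

definition matrix_ring :: "nat \<Rightarrow> ('a::{ring, monoid_mult} mat) ring" where
  "matrix_ring n =
     \<lparr>carrier = carrier_mat n n, mult = (*), one = 1\<^sub>m n, zero = 0\<^sub>m n n, add = (+)\<rparr>"

lemma matrix_ring_eq_ring_mat: "matrix_ring n = ring_mat TYPE('a::ring_1) n ()"
  by (simp add: matrix_ring_def ring_mat_def)

lemma ring_matrix_ring: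
  "Ring.ring (matrix_ring n :: ('a::{ring, monoid_mult} mat) ring)"
proof -
  have one_left: "1\<^sub>m n * A = A" and one_right: "A * 1\<^sub>m n = A"
    if A: "A \<in> carrier_mat n n" for A :: "'a mat"
    using A
    by (auto intro!: eq_matI simp: scalar_prod_def if_distrib if_distribR sum.delta sum.delta'
        cong: if_cong)
  have neg: "\<exists>B\<in>carrier_mat n n. A + B = 0\<^sub>m n n" if "A \<in> carrier_mat n n" for A :: "'a mat"
    using that by (intro bexI[of _ "- A"]) auto
  show ?thesis
    by (rule ringI; (rule abelian_groupI monoidI)?)
      (auto simp: matrix_ring_def one_left one_right neg add_mult_distrib_mat[of _ n n _ _ n]
        mult_add_distrib_mat[of _ n n _ n] assoc_add_mat[of _ n n] comm_add_mat[of _ n n]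
        assoc_mult_mat[of _ n n _ n _ n])
qed

text \<open>
  \<open>\<theta>\<close> is a relation on \<open>{1..n}\<close>, whereas matrix entries are indexed from \<open>0\<close>.
\<close>

definition structural_matrices ::
    "nat \<Rightarrow> (nat \<times> nat) set \<Rightarrow> ('a::{ring, monoid_mult}) mat set" where
  "structural_matrices n \<theta> = {A \<in> carrier_mat n n.
     \<forall>i\<in>{1..n}. \<forall>j\<in>{1..n}. (i, j) \<notin> \<theta> \<longrightarrow> A $$ (i - 1, j - 1) = 0}"

end

theory Submission
  imports Defs "HOL-Combinatorics.Multiset_Permutations" "HOL-Library.Sublist"
begin

text \<open>
  Let \<open>(i, j) \<notin> \<theta>\<close> and let \<open>J\<close> be the set of all \<open>y\<close> with \<open>(y, j) \<in> \<theta>\<close>. By transitivity the entries of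
  \<open>A\<close> with column in \<open>J\<close> and row outside \<open>J\<close> vanish, so \<open>A\<close> is block triangular, and \<open>(i, j)\<close> lies in
  the block where \<open>A\<close> vanishes. The diagonal block of \<open>A\<close> indexed by \<open>J\<close> has the corresponding block of
  the inverse as a left inverse. If that one-sided inverse is two-sided, the inverse vanishes in the same
  block as \<open>A\<close> (\<open>inverse_vanishes_off_diagonal_block\<close>). What is needed is thus that matrix rings over a
  PI-ring \<open>R\<close> are directly finite: \<open>P Q = 1\<close> implies \<open>Q P = 1\<close> (\<open>matrix_ring_directly_finite\<close>).

  If \<open>P Q = 1\<close> but \<open>Q P \<noteq> 1\<close>, the matrix ring contains nonzero matrix units of arbitrarily large size.
  These violate every multilinear identity with coprime integer coefficients, since a staircase
  \<open>e\<^bsub>0,1\<^esub> e\<^bsub>1,2\<^esub> \<cdots> e\<^bsub>n-1,n\<^esub>\<close> has a nonzero product in one order of its factors only. It remains to find such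
  an identity for each entry of matrices over \<open>R\<close> (\<open>matrix_entry_identity\<close>). This is done by counting, following Regev and
  Latyshev. The identity of \<open>R\<close> can be made multilinear of some degree \<open>d\<close> with a coefficient \<open>1\<close>
  (\<open>PI_ring_multilinear_identity\<close>), and then rewrites every multilinear monomial in \<open>n\<close> variables as an
  integer combination of monomials without decreasing subsequence of length \<open>d\<close>
  (\<open>latyshev_straightening\<close>). At most \<open>d\<^sup>n d\<^sup>n\<close> such monomials exist (\<open>card_good_words\<close>). Passing to \<open>k\<close>
  by \<open>k\<close> matrices multiplies the number by at most \<open>(k\<^sup>2)\<^sup>n\<close>, which remains exponential in \<open>n\<close>, whereas
  there are \<open>n!\<close> multilinear monomials. For large \<open>n\<close> these are linearly dependent over \<open>\<int>\<close>.
\<close>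

section \<open>Integer multiples in a ring\<close>

lemma int_scale_add_one: "int_scale (k + 1) x = int_scale k x + x"
proof (cases "k \<ge> 0")
  case True
  then have "nat (k + 1) = Suc (nat k)" "nat (- k) = 0" "nat (- (k + 1)) = 0" by auto
  then show ?thesis by (simp add: int_scale_def add.commute)
next
  case False
  then have "nat (- k) = Suc (nat (- (k + 1)))" "nat k = 0" "nat (k + 1) = 0" by auto
  then show ?thesis by (simp add: int_scale_def algebra_simps)
qed

lemma int_scale_zero_left: "int_scale 0 x = 0"
  by (simp add: int_scale_def)

lemma int_scale_diff_one: "int_scale (k - 1) x = int_scale k x - x"
  using int_scale_add_one[of "k - 1" x] by (simp add: algebra_simps)

lemma int_scale_add_left: "int_scale (k + l) x = int_scale k x + int_scale l x"
proof (induction l rule: int_induct[where k = 0])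
  case base
  then show ?case by (simp add: int_scale_zero_left)
next
  case (step1 l)
  then show ?case
    by (simp only: int_scale_add_one add.assoc[symmetric])
next
  case (step2 l)
  then show ?case
    by (simp only: int_scale_diff_one add_diff_eq)
qed

lemma int_scale_add_right: "int_scale k (x + y) = int_scale k x + int_scale k y"
  by (simp add: int_scale_def sum.distrib algebra_simps)

lemma int_scale_one: "int_scale 1 x = x"
  by (simp add: int_scale_def)

global_interpretation int_scale: Modules.module "int_scale :: int \<Rightarrow> 'a::ab_group_add \<Rightarrow> 'a"
proof
  fix k l :: int and x y :: 'a
  show "int_scale k (x + y) = int_scale k x + int_scale k y"
    by (rule int_scale_add_right)
  show add: "int_scale (k + l) x = int_scale k x + int_scale l x" for k l
    by (rule int_scale_add_left)
  show "int_scale k (int_scale l x) = int_scale (k * l) x"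
  proof (induction k rule: int_induct[where k = 0])
    case base
    then show ?case by (simp add: int_scale_zero_left)
  next
    case (step1 i)
    then show ?case by (simp add: int_scale_one distrib_right int_scale_add_left)
  next
    case (step2 i)
    have "int_scale (i * l - l) x = int_scale (i * l) x - int_scale l x"
      using int_scale_add_left[of "i * l - l" l x] by (simp add: algebra_simps)
    with step2 show ?case by (simp add: int_scale_diff_one left_diff_distrib)
  qed
  show "int_scale 1 x = x" by (rule int_scale_one)
qed

lemma mult_int_scale_right: "x * int_scale k y = int_scale k (x * y)"
  for x y :: "'a::ring"
  by (simp add: int_scale_def right_diff_distrib sum_distrib_left)

text \<open>
  The integers that annihilate \<open>x\<close> form an ideal, which by Bezout contains the gcd of any finite
  subset.
\<close>

lemma annihilated_by_Gcd:
  assumes "finite S" and "\<And>m. m \<in> S \<Longrightarrow> int_scale m x = 0"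
  shows "int_scale (Gcd S) x = 0"
  using assms
proof (induction S rule: finite_induct)
  case empty
  then show ?case by simp
next
  case (insert m S)
  obtain u v where "u * m + v * Gcd S = gcd m (Gcd S)"
    using bezout_int by blast
  then have "int_scale (Gcd (insert m S)) x
      = int_scale u (int_scale m x) + int_scale v (int_scale (Gcd S) x)"
    by (simp add: int_scale_add_left[symmetric])
  with insert show ?case by simp
qed

section \<open>Multilinear identities\<close>

lemma prod_list_map_sum:
  fixes y :: "'b \<Rightarrow> 'a::{semiring_0, monoid_mult}"
  assumes "finite T"
  shows "prod_list (map (\<lambda>i. \<Sum>j | j \<in> T \<and> p j = i. y j) v)
    = (\<Sum>h | set h \<subseteq> T \<and> map p h = v. prod_list (map y h))"
proof (induction v)
  case Nil
  have "{h. set h \<subseteq> T \<and> map p h = []} = {[]}" by auto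
  then show ?case by simp
next
  case (Cons i v)
  let ?L = "\<lambda>v. {h. set h \<subseteq> T \<and> map p h = v}"
  have L: "?L (i # v) = (\<lambda>(j, h). j # h) ` ({j. j \<in> T \<and> p j = i} \<times> ?L v)"
    by (auto simp: map_eq_Cons_conv image_iff)
  have inj: "inj_on (\<lambda>(j, h). j # h) ({j. j \<in> T \<and> p j = i} \<times> ?L v)"
    by (auto simp: inj_on_def)
  show ?case
    unfolding L sum.reindex[OF inj]
    by (simp add: Cons.IH sum_product sum.cartesian_product case_prod_unfold)
qed

text \<open>
  Polarization: every variable is replaced by a sum of fresh letters, \<open>p\<close> telling which variable
  a letter stands for. If \<open>w\<close> is a word and \<open>p = (!) w\<close>, the letters are the positions of \<open>w\<close>, so that
  repeated variables of \<open>w\<close> are pulled apart.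
\<close>

lemma nc_eval_substitute_letter_sums:
  fixes y :: "nat \<Rightarrow> 'a::{ring, monoid_mult}"
  assumes fin: "finite T" and deg: "\<And>v. v \<in> Poly_Mapping.keys f \<Longrightarrow> length v \<le> d"
  shows "nc_eval (\<lambda>i. \<Sum>j | j \<in> T \<and> p j = i. y j) f
    = (\<Sum>h | set h \<subseteq> T \<and> length h \<le> d.
        int_scale (Poly_Mapping.lookup f (map p h)) (prod_list (map y h)))"
proof -
  let ?K = "Poly_Mapping.keys f"
  let ?H = "{h. set h \<subseteq> T \<and> length h \<le> d}"
  let ?t = "\<lambda>h. int_scale (Poly_Mapping.lookup f (map p h)) (prod_list (map y h))"
  have finH: "finite ?H" using finite_lists_length_le[OF fin] .
  have "nc_eval (\<lambda>i. \<Sum>j | j \<in> T \<and> p j = i. y j) f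
      = (\<Sum>v\<in>?K. \<Sum>h | set h \<subseteq> T \<and> map p h = v. ?t h)"
    unfolding nc_eval_def prod_list_map_sum[OF fin]
    by (intro sum.cong refl) (auto simp: int_scale.scale_sum_right)
  also have "\<dots> = (\<Sum>v\<in>?K. \<Sum>h | h \<in> {h \<in> ?H. map p h \<in> ?K} \<and> map p h = v. ?t h)"
    using deg by (intro sum.cong refl) (auto, metis length_map)
  also have "\<dots> = (\<Sum>h | h \<in> ?H \<and> map p h \<in> ?K. ?t h)"
    by (subst sum.group) (auto intro: finite_subset[OF _ finH])
  also have "\<dots> = (\<Sum>h\<in>?H. ?t h)"
    using finH by (intro sum.mono_neutral_left) (auto simp: in_keys_iff)
  finally show ?thesis .
qed

text \<open>
  Setting a letter \<open>j\<close> to \<open>0\<close> kills exactly the words that contain \<open>j\<close>. The remaining words therefore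
  give an identity by themselves, and so do, by subtraction, the words containing \<open>j\<close>.
\<close>

lemma identity_restricts_to_words_containing:
  fixes c :: "'b list \<Rightarrow> int"
  assumes "finite L" and "finite H"
    and "\<And>y :: 'b \<Rightarrow> 'a::{ring, monoid_mult}.
      (\<Sum>h\<in>H. int_scale (c h) (prod_list (map y h))) = 0"
  shows "(\<Sum>h | h \<in> H \<and> L \<subseteq> set h. int_scale (c h) (prod_list (map (y :: 'b \<Rightarrow> 'a) h))) = 0"
  using assms(1)
proof (induction L arbitrary: y rule: finite_induct)
  case empty
  then show ?case using assms(3) by simp
next
  case (insert j L)
  let ?t = "\<lambda>y h. int_scale (c h) (prod_list (map (y :: 'b \<Rightarrow> 'a) h))"
  let ?A = "{h \<in> H. insert j L \<subseteq> set h}" and ?B = "{h \<in> H. L \<subseteq> set h \<and> j \<notin> set h}"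
  have split: "{h \<in> H. L \<subseteq> set h} = ?A \<union> ?B" "?A \<inter> ?B = {}" by auto
  have fin: "finite ?A" "finite ?B" using assms(2) by auto
  have total: "sum (?t y) ?A + sum (?t y) ?B = 0" for y
    using insert.IH[of y] sum.union_disjoint[OF fin split(2), of "?t y"]
    by (simp only: split(1))
  have "sum (?t (y(j := 0))) ?A = 0"
    by (intro sum.neutral) (auto simp: prod_list_zero_iff dest!: split_list)
  moreover have "sum (?t (y(j := 0))) ?B = sum (?t y) ?B"
    by (intro sum.cong refl arg_cong2[of _ _ _ _ int_scale] arg_cong[of _ _ prod_list]) auto
  ultimately have "sum (?t y) ?B = 0" using total[of "y(j := 0)"] by simp
  with total[of y] show ?case by simp
qed

text \<open>
  Polarize along a word \<open>w\<close> of maximal length \<open>d\<close> with coefficient \<open>1\<close> and keep the words in which all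
  \<open>d\<close> letters occur. As no word is longer than \<open>d\<close>, these are the permutations of the letters, and the
  identity permutation inherits the coefficient of \<open>w\<close>.
\<close>

lemma PI_ring_multilinear_identity:
  assumes "PI_ring TYPE('a::{ring, monoid_mult})"
  obtains d :: nat and c :: "nat list \<Rightarrow> int" where "c [0..<d] = 1"
    and "\<And>y :: nat \<Rightarrow> 'a.
      (\<Sum>h\<in>permutations_of_set {..<d}. int_scale (c h) (prod_list (map y h))) = 0"
proof -
  from assms obtain f :: nc_poly and w where lead: "Poly_Mapping.lookup f w = 1"
    and deg: "\<And>v. v \<in> Poly_Mapping.keys f \<Longrightarrow> length v \<le> length w"
    and id: "\<And>x :: nat \<Rightarrow> 'a. nc_eval x f = 0"
    unfolding PI_ring_def by blast
  define d where "d = length w"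
  define c where "c h = Poly_Mapping.lookup f (map ((!) w) h)" for h
  let ?H = "{h. set h \<subseteq> {..<d} \<and> length h \<le> d}"
  have "(\<Sum>h\<in>?H. int_scale (c h) (prod_list (map y h))) = 0" for y :: "nat \<Rightarrow> 'a"
    using nc_eval_substitute_letter_sums[where T = "{..<d}" and d = d and f = f and p = "(!) w" and y = y] id deg
    by (simp add: c_def d_def)
  moreover have "{h \<in> ?H. {..<d} \<subseteq> set h} = permutations_of_set {..<d}"
  proof (intro equalityI subsetI)
    fix h assume h: "h \<in> {h \<in> ?H. {..<d} \<subseteq> set h}"
    then have "set h = {..<d}" "length h \<le> d" by auto
    moreover from this have "card (set h) = length h"
      using card_length[of h] by simp
    ultimately show "h \<in> permutations_of_set {..<d}"
      by (auto simp: permutations_of_set_def card_distinct)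
  next
    fix h assume h: "h \<in> permutations_of_set {..<d}"
    then have "length h = d"
      using length_finite_permutations_of_set by fastforce
    with h show "h \<in> {h \<in> ?H. {..<d} \<subseteq> set h}"
      by (auto simp: permutations_of_set_def)
  qed
  ultimately have "(\<Sum>h\<in>permutations_of_set {..<d}. int_scale (c h) (prod_list (map y h))) = 0"
    for y :: "nat \<Rightarrow> 'a"
    using identity_restricts_to_words_containing[of "{..<d}" ?H c y]
      finite_lists_length_le[of "{..<d}" d] by simp
  moreover have "c [0..<d] = 1" using lead by (simp add: c_def d_def map_nth)
  ultimately show thesis using that by blast
qed

section \<open>Straightening monomials to words without long decreasing subsequences\<close>

definition monomial :: "('b \<Rightarrow> 'a::monoid_mult) \<Rightarrow> 'b list \<Rightarrow> 'a" where
  "monomial r w = prod_list (map r w)"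

definition decreasing_bounded :: "nat \<Rightarrow> nat list \<Rightarrow> bool" where
  "decreasing_bounded d w \<longleftrightarrow> (\<forall>us. subseq us w \<and> sorted_wrt (>) us \<longrightarrow> length us < d)"

definition good_words :: "nat \<Rightarrow> nat \<Rightarrow> nat list set" where
  "good_words d n = {w \<in> permutations_of_set {..<n}. decreasing_bounded d w}"

text \<open>
  Cut \<open>w\<close> in front of each letter of the subsequence.
\<close>

lemma subseq_imp_block_factorisation:
  assumes "subseq us w"
  shows "\<exists>pre bs. w = pre @ concat bs \<and> [] \<notin> set bs \<and> map hd bs = us"
  using assms
proof (induction rule: list_emb.induct)
  case (list_emb_Nil ys)
  show ?case by (rule exI[of _ ys], rule exI[of _ "[]"]) simp
next
  case (list_emb_Cons xs ys y)
  then obtain pre bs where "ys = pre @ concat bs" "[] \<notin> set bs" "map hd bs = xs" by blast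
  then show ?case by (intro exI[of _ "y # pre"] exI[of _ bs]) simp
next
  case (list_emb_Cons2 x y xs ys)
  then obtain pre bs where "ys = pre @ concat bs" "[] \<notin> set bs" "map hd bs = xs" by blast
  with list_emb_Cons2 show ?case
    by (intro exI[of _ "[]"] exI[of _ "(y # pre) # bs"]) simp
qed

text \<open>
  At the first place \<open>i\<close> where a permutation differs from the identity, all smaller values are already
  used up, so that the value there exceeds \<open>i\<close>.
\<close>

lemma permutation_first_displacement:
  assumes "h \<noteq> [0..<d]" and "set h = {..<d}" and "distinct h"
  obtains i j h' where "h = [0..<i] @ j # h'" and "i < j" and "j < d"
proof -
  have len: "length h = d"
    using assms(2,3) distinct_card[of h] by simp
  have "\<exists>i<d. h ! i \<noteq> i"
    using assms(1) len by (metis diff_zero length_upt nth_equalityI nth_upt add_0)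
  then obtain i where i: "i < d \<and> h ! i \<noteq> i" and "\<And>l. l < i \<Longrightarrow> \<not> (l < d \<and> h ! l \<noteq> l)"
    using exists_least_iff[of "\<lambda>i. i < d \<and> h ! i \<noteq> i"] by blast
  then have min: "\<And>l. l < i \<Longrightarrow> h ! l = l" by (meson less_trans)
  have h: "h = take i h @ h ! i # drop (Suc i) h"
    using i len by (simp add: id_take_nth_drop)
  moreover have tk: "take i h = [0..<i]"
    using i len min by (intro nth_equalityI) auto
  moreover have "h ! i < d"
    using assms(2) i len nth_mem[of i h] by simp
  moreover have "\<not> h ! i < i"
  proof
    assume lt: "h ! i < i"
    then have "h ! (h ! i) = h ! i" using min by blast
    with lt i len assms(3) nth_eq_iff_index_eq[of h "h ! i" i] show False by simp
  qed
  ultimately show thesis using that[of i "h ! i" "drop (Suc i) h"] i by simp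
qed

lemma mset_permuted_blocks:
  assumes "h \<in> permutations_of_set {..<length bs}"
  shows "mset (map ((!) bs) h) = mset bs"
proof -
  have "set h = {..<length bs}" "distinct h"
    using assms by (auto simp: permutations_of_set_def)
  then have "mset h = mset [0..<length bs]"
    using mset_set_set[of h] by (simp add: lessThan_atLeast0)
  then show ?thesis by (metis map_nth mset_map)
qed

text \<open>
  The first block that is displaced is replaced by a later one, and the first letters of the blocks
  decrease.
\<close>

lemma block_permutation_lex_smaller:
  assumes ne: "[] \<notin> set bs" and dec: "sorted_wrt (>) (map hd bs)"
    and h: "h \<in> permutations_of_set {..<length bs}" "h \<noteq> [0..<length bs]"
  shows "(pre @ concat (map ((!) bs) h), pre @ concat bs) \<in> lex {(x, y). x < (y :: nat)}"
proof -
  let ?d = "length bs"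
  from h have hset: "set h = {..<?d}" "distinct h" by (auto simp: permutations_of_set_def)
  obtain i j h' where hij: "h = [0..<i] @ j # h'" "i < j" "j < ?d"
    using permutation_first_displacement[OF h(2) hset] .
  have lt: "hd (bs ! j) < hd (bs ! i)"
    using dec hij(2,3) sorted_wrt_nth_less[OF dec, of i j] by simp
  obtain x u where u: "bs ! j = x # u"
    using ne hij(3) nth_mem[of j bs] by (cases "bs ! j") auto
  obtain y v where v: "bs ! i = y # v"
    using ne hij(2,3) nth_mem[of i bs] by (cases "bs ! i") auto
  have "take i bs = map ((!) bs) [0..<i]"
    using hij(2,3) by (intro nth_equalityI) auto
  then have bs: "bs = map ((!) bs) [0..<i] @ bs ! i # drop (Suc i) bs"
    using id_take_nth_drop[of i bs] hij(2,3) by simp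
  define p where "p = concat (map ((!) bs) [0..<i])"
  have w: "concat bs = p @ y # v @ concat (drop (Suc i) bs)"
    by (subst (1) bs) (simp only: v p_def concat_append concat.simps append_Cons)
  have w': "concat (map ((!) bs) h) = p @ x # u @ concat (map ((!) bs) h')"
    by (simp add: hij(1) u p_def)
  have "mset (map ((!) bs) h) = mset bs" using mset_permuted_blocks[OF h(1)] .
  then have "length (concat (map ((!) bs) h)) = length (concat bs)"
    by (metis length_concat mset_map sum_mset_sum_list)
  moreover have "x < y" using lt u v by simp
  ultimately show ?thesis
    unfolding lex_conv w w'
    by (auto intro!: exI[of _ "pre @ p"])
qed

lemma block_permutation_is_permutation:
  assumes h: "h \<in> permutations_of_set {..<length bs}"
    and w: "pre @ concat bs \<in> permutations_of_set B"
  shows "pre @ concat (map ((!) bs) h) \<in> permutations_of_set B"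
proof -
  have "mset (map ((!) bs) h) = mset bs" using mset_permuted_blocks[OF h] .
  then have "mset (concat (map ((!) bs) h)) = mset (concat bs)"
    by (metis mset_concat mset_map sum_mset_sum_list)
  then have "mset (pre @ concat (map ((!) bs) h)) = mset (pre @ concat bs)" by simp
  with w show ?thesis
    unfolding permutations_of_set_def mem_Collect_eq
    by (metis mset_eq_imp_distinct_iff mset_eq_setD)
qed

lemma monomial_append: "monomial r (u @ v) = monomial r u * monomial r v"
  by (simp add: monomial_def)

lemma monomial_concat: "monomial r (concat ws) = prod_list (map (monomial r) ws)"
  by (induction ws) (simp_all add: monomial_append, simp add: monomial_def)

lemma finite_good_words [simp]: "finite (good_words d n)"
  by (simp add: good_words_def)

text \<open>
  Latyshev's argument. A word with a decreasing subsequence of length \<open>d\<close> is, after a prefix, a product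
  of \<open>d\<close> blocks with decreasing first letters. The multilinear identity of degree \<open>d\<close>, evaluated at the
  blocks, expresses it by words in which the blocks are permuted nontrivially. These are
  lexicographically smaller permutations of the same letters, so the process ends. The coefficients
  depend on the word only and not on the elements \<open>r\<close> substituted for the letters, which is what
  allows the linear algebra over \<open>\<int>\<close> below to handle all substitutions at once.
\<close>

lemma latyshev_straightening:
  fixes c :: "nat list \<Rightarrow> int"
  assumes lead: "c [0..<d] = 1"
    and id: "\<And>y :: nat \<Rightarrow> 'a::{ring, monoid_mult}.
      (\<Sum>h\<in>permutations_of_set {..<d}. int_scale (c h) (monomial y h)) = 0"
    and "w \<in> permutations_of_set {..<n}"
  shows "\<exists>a :: nat list \<Rightarrow> int. \<forall>r :: nat \<Rightarrow> 'a.
    monomial r w = (\<Sum>\<tau>\<in>good_words d n. int_scale (a \<tau>) (monomial r \<tau>))"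
  using assms(3)
proof (induction w rule: wf_induct_rule[OF wf_lex[OF wf]])
  case (1 w)
  show ?case
  proof (cases "decreasing_bounded d w")
    case True
    then have "w \<in> good_words d n" using 1(2) by (simp add: good_words_def)
    then show ?thesis
      by (intro exI[of _ "\<lambda>\<tau>. of_bool (\<tau> = w)"] allI)
        (simp add: of_bool_def if_distrib[of "\<lambda>k. int_scale k _"] sum.delta cong: if_cong)
  next
    case False
    then obtain us where us: "subseq us w" "sorted_wrt (>) us" "d \<le> length us"
      by (auto simp: decreasing_bounded_def not_less)
    have "subseq (take d us) w"
      using subseq_order.trans[OF prefix_imp_subseq[OF take_is_prefix] us(1)] .
    moreover have "sorted_wrt (>) (take d us)"
      using us(2) by (simp add: sorted_wrt_take)
    ultimately obtain pre bs where w: "w = pre @ concat bs" and ne: "[] \<notin> set bs"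
      and dec: "sorted_wrt (>) (map hd bs)" and "map hd bs = take d us"
      using subseq_imp_block_factorisation by metis
    then have len: "length bs = d" using us(3) by (metis length_map length_take min.absorb2)
    let ?H = "permutations_of_set {..<d} - {[0..<d]}"
    let ?v = "\<lambda>h. pre @ concat (map ((!) bs) h)"
    have "\<exists>a :: nat list \<Rightarrow> int. \<forall>r :: nat \<Rightarrow> 'a.
        monomial r (?v h) = (\<Sum>\<tau>\<in>good_words d n. int_scale (a \<tau>) (monomial r \<tau>))"
      if "h \<in> ?H" for h
      using that 1 block_permutation_lex_smaller[OF ne dec, of h pre]
        block_permutation_is_permutation[of h bs pre] by (auto simp: len w)
    then obtain a :: "nat list \<Rightarrow> nat list \<Rightarrow> int" where a: "\<And>h (r :: nat \<Rightarrow> 'a). h \<in> ?H \<Longrightarrow>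
        monomial r (?v h) = (\<Sum>\<tau>\<in>good_words d n. int_scale (a h \<tau>) (monomial r \<tau>))"
      by metis
    have "monomial r w = (\<Sum>\<tau>\<in>good_words d n.
        int_scale (\<Sum>h\<in>?H. - c h * a h \<tau>) (monomial r \<tau>))" for r :: "nat \<Rightarrow> 'a"
    proof -
      let ?y = "\<lambda>i. monomial r (bs ! i)"
      have blocks: "monomial r (?v h) = monomial r pre * monomial ?y h" for h
        by (simp add: monomial_append monomial_concat comp_def) (simp add: monomial_def)
      have mem: "[0..<d] \<in> permutations_of_set {..<d}"
        by (auto simp: permutations_of_set_def)
      have "w = ?v [0..<d]" by (simp add: w len[symmetric] map_nth)
      then have "monomial r w = monomial r pre * monomial ?y [0..<d]" using blocks by metis
      also have "monomial ?y [0..<d] = - (\<Sum>h\<in>?H. int_scale (c h) (monomial ?y h))"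
        using id[of ?y] lead
        by (subst (asm) sum.remove[OF _ mem]) (auto simp: eq_neg_iff_add_eq_0)
      also have "monomial r pre * \<dots> = (\<Sum>h\<in>?H. int_scale (- c h) (monomial r (?v h)))"
        by (simp add: blocks sum_distrib_left mult_int_scale_right sum_negf)
      also have "\<dots> = (\<Sum>h\<in>?H. \<Sum>\<tau>\<in>good_words d n. int_scale (- c h * a h \<tau>) (monomial r \<tau>))"
        by (intro sum.cong refl) (simp add: a int_scale.scale_sum_right)
      also have "\<dots> = (\<Sum>\<tau>\<in>good_words d n. \<Sum>h\<in>?H. int_scale (- c h * a h \<tau>) (monomial r \<tau>))"
        by (rule sum.swap)
      finally show ?thesis by (simp only: int_scale.scale_sum_left)
    qed
    then show ?thesis by (intro exI allI)
  qed
qed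

section \<open>Counting words without long decreasing subsequences\<close>

lemma eq_if_same_colours_and_classes:
  assumes "map \<kappa> v = map \<kappa> w"
    and "\<And>c. filter (\<lambda>x. \<kappa> x = c) v = filter (\<lambda>x. \<kappa> x = c) w"
  shows "v = w"
  using assms
proof (induction v arbitrary: w)
  case Nil
  then show ?case by simp
next
  case (Cons x v)
  then obtain y u where w: "w = y # u" "\<kappa> y = \<kappa> x" "map \<kappa> v = map \<kappa> u"
    by (auto simp: map_eq_Cons_conv Cons_eq_map_conv)
  have xy: "x = y" using Cons.prems(2)[of "\<kappa> x"] w by simp
  have "filter (\<lambda>x. \<kappa> x = c) v = filter (\<lambda>x. \<kappa> x = c) u" for c
    using Cons.prems(2)[of c] w(1) xy by (simp split: if_splits)
  with Cons.IH w xy show ?case by blast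
qed

text \<open>
  For a letter \<open>x\<close> of \<open>w\<close>, this is one less than the largest length of a decreasing subsequence of \<open>w\<close>
  that ends with \<open>x\<close>.
\<close>

definition decreasing_rank :: "nat list \<Rightarrow> nat \<Rightarrow> nat" where
  "decreasing_rank w x = Max {length us | us. subseq (us @ [x]) w \<and> sorted_wrt (>) (us @ [x])}"

lemma finite_decreasing_rank:
  "finite {length us | us. subseq (us @ [x]) w \<and> sorted_wrt (>) (us @ [x])}"
proof (rule finite_subset)
  show "{length us | us. subseq (us @ [x]) w \<and> sorted_wrt (>) (us @ [x])} \<subseteq> {..length w}"
    by (force dest: list_emb_length)
qed simp

lemma decreasing_rank_attained:
  assumes "x \<in> set w"
  obtains us where "subseq (us @ [x]) w" and "sorted_wrt (>) (us @ [x])"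
    and "length us = decreasing_rank w x"
proof -
  have "0 \<in> {length us | us. subseq (us @ [x]) w \<and> sorted_wrt (>) (us @ [x])}"
    using assms by (auto intro!: exI[of _ "[]"] simp: subseq_singleton_left)
  then have "decreasing_rank w x \<in> {length us | us. subseq (us @ [x]) w \<and> sorted_wrt (>) (us @ [x])}"
    unfolding decreasing_rank_def by (intro Max_in finite_decreasing_rank) blast
  then show thesis using that by auto
qed

text \<open>
  A decreasing subsequence ending with \<open>x\<close> can be prolonged by any smaller letter to the right of
  \<open>x\<close>.
\<close>

lemma decreasing_rank_less:
  assumes "distinct (u @ x # v)" and "y \<in> set v" and "y < x"
  shows "decreasing_rank (u @ x # v) x < decreasing_rank (u @ x # v) y"
proof -
  let ?w = "u @ x # v"
  obtain us where us: "subseq (us @ [x]) ?w" "sorted_wrt (>) (us @ [x])"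
    "length us = decreasing_rank ?w x"
    using decreasing_rank_attained[of x ?w] by auto
  have "subseq (us @ [x]) (u @ [x])"
  proof -
    obtain a b where ab: "us @ [x] = a @ b" "subseq a (u @ [x])" "subseq b v"
      using us(1) by (metis append.assoc append_Cons append_Nil subseq_appendE)
    have "b = []"
    proof (rule ccontr)
      assume "b \<noteq> []"
      then have "x \<in> set b" using ab(1) by (metis last_appendR last_in_set last_snoc)
      then show False
        using list_emb_set[OF ab(3), of x] assms(1) by auto
    qed
    with ab show ?thesis by simp
  qed
  then have "subseq ((us @ [x]) @ [y]) ((u @ [x]) @ v)"
    using assms(2) by (intro list_emb_append_mono) (simp_all add: subseq_singleton_left)
  moreover have "sorted_wrt (>) ((us @ [x]) @ [y])"
    using us(2) assms(3) by (auto simp: sorted_wrt_append)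
  ultimately have "Suc (length us) \<le> decreasing_rank ?w y"
    unfolding decreasing_rank_def
    by (intro Max_ge finite_decreasing_rank) (force intro!: exI[of _ "us @ [x]"])
  with us(3) show ?thesis by simp
qed

lemma sorted_decreasing_rank_class:
  assumes "distinct w"
  shows "sorted (filter (\<lambda>x. decreasing_rank w x = c) w)"
proof -
  have "sorted (filter (\<lambda>x. decreasing_rank w x = c) v)" if "w = u @ v" for u v
    using that
  proof (induction v arbitrary: u)
    case Nil
    then show ?case by simp
  next
    case (Cons x v)
    have "x \<le> y" if "y \<in> set v" "decreasing_rank w x = c" "decreasing_rank w y = c" for y
      using decreasing_rank_less[of u x v y] that Cons.prems assms by (metis less_irrefl not_less)
    with Cons.IH[of "u @ [x]"] Cons.prems show ?case by auto
  qed
  from this[of "[]" w] show ?thesis by simp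
qed

text \<open>
  Colour each letter by its decreasing rank: there are at most \<open>d\<close> colours, and the letters of one colour
  increase from left to right. The word is therefore recovered from the colour of each position
  together with the colour of each letter. The bound is exponential in \<open>n\<close>, while there are
  \<open>n!\<close> words altogether.
\<close>

lemma card_good_words: "card (good_words d n) \<le> d ^ n * d ^ n"
proof -
  let ?code = "\<lambda>w. (map (decreasing_rank w) w, map (decreasing_rank w) [0..<n])"
  let ?L = "{xs. set xs \<subseteq> {..<d} \<and> length xs = n}"
  have "inj_on ?code (good_words d n)"
  proof (rule inj_onI)
    fix v w
    assume v: "v \<in> good_words d n" and w: "w \<in> good_words d n" and eq: "?code v = ?code w"
    then have sets: "set v = {..<n}" "set w = {..<n}" "distinct v" "distinct w"
      by (auto simp: good_words_def permutations_of_set_def)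
    from eq have rank: "decreasing_rank v x = decreasing_rank w x" if "x < n" for x
      using that by (auto simp: map_eq_conv)
    have "map (decreasing_rank w) v = map (decreasing_rank w) w"
    proof -
      have "map (decreasing_rank w) v = map (decreasing_rank v) v"
        using rank sets(1) by (intro map_cong) auto
      also have "\<dots> = map (decreasing_rank w) w" using eq by (simp only: prod.inject)
      finally show ?thesis .
    qed
    moreover have "filter (\<lambda>x. decreasing_rank w x = c) v = filter (\<lambda>x. decreasing_rank w x = c) w" for c
    proof -
      have "filter (\<lambda>x. decreasing_rank w x = c) v = filter (\<lambda>x. decreasing_rank v x = c) v"
        using rank sets(1) by (intro filter_cong) auto
      then have "sorted (filter (\<lambda>x. decreasing_rank w x = c) v)"
        using sorted_decreasing_rank_class[OF sets(3), of c] by simp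
      moreover have "set (filter (\<lambda>x. decreasing_rank w x = c) v)
          = set (filter (\<lambda>x. decreasing_rank w x = c) w)"
        using sets(1,2) by simp
      ultimately show ?thesis
        using sorted_decreasing_rank_class[OF sets(4), of c] sets(3,4)
        by (intro sorted_distinct_set_unique distinct_filter)
    qed
    ultimately show "v = w" by (rule eq_if_same_colours_and_classes)
  qed
  moreover have "?code ` good_words d n \<subseteq> ?L \<times> ?L"
  proof (rule image_subsetI)
    fix w assume w: "w \<in> good_words d n"
    then have sets: "set w = {..<n}" "distinct w"
      by (auto simp: good_words_def permutations_of_set_def)
    have "decreasing_rank w x < d" if "x < n" for x
    proof -
      have "x \<in> set w" using that sets by simp
      then obtain us where "subseq (us @ [x]) w" "sorted_wrt (>) (us @ [x])"
        "length us = decreasing_rank w x"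
        by (rule decreasing_rank_attained)
      with w show ?thesis by (force simp: good_words_def decreasing_bounded_def)
    qed
    moreover have "length w = n" using sets distinct_card[of w] by simp
    ultimately show "?code w \<in> ?L \<times> ?L" using sets by auto
  qed
  ultimately have "card (good_words d n) \<le> card (?L \<times> ?L)"
    by (rule card_inj_on_le) (simp add: finite_lists_length_eq)
  then show ?thesis by (simp add: card_cartesian_product card_lists_length_eq)
qed

section \<open>Linear dependence over the integers\<close>

lemma exponential_less_fact: "\<exists>n. C ^ n < (fact n :: nat)"
proof -
  have "summable (\<lambda>n. inverse (fact n) * real C ^ n)"
    by (rule summable_exp)
  then have "eventually (\<lambda>n. inverse (fact n) * real C ^ n < 1) sequentially"
    by (intro order_tendstoD(2)[OF summable_LIMSEQ_zero]) auto
  then obtain n where "inverse (fact n) * real C ^ n < 1"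
    by (auto simp: eventually_sequentially)
  then have "real (C ^ n) < real (fact n)" by (simp add: field_simps)
  then show ?thesis using of_nat_less_iff by blast
qed

text \<open>
  Gaussian elimination without division: one equation and one unknown are eliminated at a time.
\<close>

lemma integer_linear_dependence:
  fixes M :: "'s \<Rightarrow> 't \<Rightarrow> int"
  assumes "finite T" and "finite S" and "card T < card S"
  shows "\<exists>c. (\<exists>s\<in>S. c s \<noteq> 0) \<and> (\<forall>t\<in>T. (\<Sum>s\<in>S. c s * M s t) = 0)"
  using assms
proof (induction T arbitrary: S M rule: finite_induct)
  case empty
  then obtain s where "s \<in> S" by (metis card.empty equals0I less_irrefl)
  then show ?case by (intro exI[of _ "\<lambda>_. 1"]) auto
next
  case (insert t T)
  show ?case
  proof (cases "\<forall>s\<in>S. M s t = 0")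
    case True
    with insert.IH[of S M] insert.prems insert.hyps show ?thesis by auto
  next
    case False
    then obtain s0 where s0: "s0 \<in> S" "M s0 t \<noteq> 0" by blast
    let ?S = "S - {s0}"
    have "card T < card ?S" using insert.prems insert.hyps s0 by (simp add: card_Diff_singleton)
    then obtain c where c: "\<exists>s\<in>?S. c s \<noteq> 0"
      "\<And>u. u \<in> T \<Longrightarrow> (\<Sum>s\<in>?S. c s * (M s0 t * M s u - M s t * M s0 u)) = 0"
      using insert.IH[of ?S "\<lambda>s u. M s0 t * M s u - M s t * M s0 u"] insert.prems(1) by auto
    \<comment> \<open>The value at s0 solves equation t; the factor M s0 t avoids fractions.\<close>
    define b where "b s = (if s = s0 then - (\<Sum>s\<in>?S. c s * M s t) else M s0 t * c s)" for s
    have bsum: "(\<Sum>s\<in>S. b s * M s u) =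
        (\<Sum>s\<in>?S. c s * (M s0 t * M s u - M s t * M s0 u))" for u
    proof -
      have "(\<Sum>s\<in>S. b s * M s u) = b s0 * M s0 u + (\<Sum>s\<in>?S. b s * M s u)"
        using sum.remove[OF insert.prems(1) s0(1)] .
      also have "b s0 * M s0 u = - (\<Sum>s\<in>?S. c s * M s t * M s0 u)"
        by (simp add: b_def sum_distrib_right)
      also have "(\<Sum>s\<in>?S. b s * M s u) = (\<Sum>s\<in>?S. M s0 t * c s * M s u)"
        by (intro sum.cong) (auto simp: b_def)
      finally show ?thesis
        by (simp only: right_diff_distrib sum_subtractf mult_ac)
    qed
    have "(\<Sum>s\<in>?S. c s * (M s0 t * M s t - M s t * M s0 t)) = 0" by (simp add: mult.commute)
    with bsum c(2) have "\<forall>u\<in>insert t T. (\<Sum>s\<in>S. b s * M s u) = 0" by auto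
    moreover have "\<exists>s\<in>S. b s \<noteq> 0" using c(1) s0(2) by (auto simp: b_def)
    ultimately show ?thesis by blast
  qed
qed

section \<open>Products of matrices as sums over paths\<close>

text \<open>
  The positions of the entries, one from each factor, whose product is a summand of the \<open>(s, t)\<close> entry
  of a product of matrices.
\<close>

primrec is_path :: "'b \<Rightarrow> ('b \<times> 'b) list \<Rightarrow> 'b \<Rightarrow> bool" where
  "is_path s [] t \<longleftrightarrow> s = t"
| "is_path s (q # qs) t \<longleftrightarrow> fst q = s \<and> is_path (snd q) qs t"

definition mat_word :: "nat \<Rightarrow> ('b \<Rightarrow> 'a::{ring, monoid_mult} mat) \<Rightarrow> 'b list \<Rightarrow> 'a mat" where
  "mat_word k X w = foldr (\<lambda>i M. X i * M) w (1\<^sub>m k)"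

lemma mat_word_simps [simp]:
  "mat_word k X [] = 1\<^sub>m k"
  "mat_word k X (i # w) = X i * mat_word k X w"
  by (simp_all add: mat_word_def)

lemma mat_word_carrier:
  assumes "\<And>i. X i \<in> carrier_mat k k"
  shows "mat_word k X w \<in> carrier_mat k k"
  by (induction w) (auto intro!: mult_carrier_mat[OF assms])

lemma mat_mult_entry:
  assumes "A \<in> carrier_mat k k" "B \<in> carrier_mat k k" "s < k" "t < k"
  shows "(A * B) $$ (s, t) = (\<Sum>u<k. A $$ (s, u) * B $$ (u, t))"
  using assms by (simp add: scalar_prod_def lessThan_atLeast0)

text \<open>
  A path assigns an index pair to each factor. As the letters of \<open>w\<close> are distinct, the assignment can be
  taken as a function \<open>g\<close> of the letter instead of its position. The index set of the sum then depends
  only on the set of letters, so that the sums for all permutations of the same letters run over the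
  same \<open>g\<close>, and for each \<open>g\<close> involve the same elements of the ring.
\<close>

lemma mat_word_entry:
  fixes X :: "'b \<Rightarrow> 'a::{ring, monoid_mult} mat"
  assumes X: "\<And>i. X i \<in> carrier_mat k k" and "distinct w" and "s < k" and t: "t < k"
  shows "mat_word k X w $$ (s, t) = (\<Sum>g\<in>set w \<rightarrow>\<^sub>E {..<k} \<times> {..<k}.
    int_scale (of_bool (is_path s (map g w) t)) (monomial (\<lambda>i. X i $$ g i) w))"
  using assms(2,3)
proof (induction w arbitrary: s)
  case Nil
  then show ?case using t by (simp add: monomial_def)
next
  case (Cons i w)
  let ?Q = "{..<k} \<times> {..<k}" and ?P = "set w \<rightarrow>\<^sub>E {..<k} \<times> {..<k}"
  let ?t = "\<lambda>w s g. int_scale (of_bool (is_path s (map g w) t)) (monomial (\<lambda>i. X i $$ g i) w)"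
  have i: "i \<notin> set w" using Cons.prems by simp
  have step: "?t (i # w) s (g(i := q)) = (if fst q = s then X i $$ q * ?t w (snd q) g else 0)"
    for g q
  proof -
    have path: "map (g(i := q)) (i # w) = q # map g w" using i by auto
    have "map (\<lambda>j. X j $$ (g(i := q)) j) (i # w) = X i $$ q # map (\<lambda>j. X j $$ g j) w"
      using i by auto
    then have "monomial (\<lambda>j. X j $$ (g(i := q)) j) (i # w) =
        X i $$ q * monomial (\<lambda>j. X j $$ g j) w"
      by (simp only: monomial_def prod_list.Cons)
    then show ?thesis
      unfolding path by (simp add: mult_int_scale_right)
  qed
  have "(\<Sum>g\<in>set (i # w) \<rightarrow>\<^sub>E ?Q. ?t (i # w) s g)
      = (\<Sum>(q, g)\<in>?Q \<times> ?P. ?t (i # w) s (g(i := q)))"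
    unfolding list.set PiE_insert_eq
    by (subst sum.reindex[OF inj_combinator[OF i]]) (simp add: case_prod_unfold)
  also have "\<dots> = (\<Sum>q\<in>?Q. \<Sum>g\<in>?P. if fst q = s then X i $$ q * ?t w (snd q) g else 0)"
    unfolding step by (rule sum.cartesian_product[symmetric])
  also have "\<dots> = (\<Sum>q\<in>?Q. if fst q = s then X i $$ q * (\<Sum>g\<in>?P. ?t w (snd q) g) else 0)"
    by (intro sum.cong refl) (simp add: sum_distrib_left)
  also have "\<dots> = (\<Sum>q\<in>?Q. if fst q = s then X i $$ q * mat_word k X w $$ (snd q, t) else 0)"
    using Cons by (intro sum.cong refl) auto
  also have "\<dots> = (\<Sum>a<k. \<Sum>u<k. if a = s then X i $$ (a, u) * mat_word k X w $$ (u, t) else 0)"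
    unfolding sum.cartesian_product by (intro sum.cong refl) auto
  also have "\<dots> = (\<Sum>u<k. X i $$ (s, u) * mat_word k X w $$ (u, t))"
    using Cons.prems by (subst sum.swap) (simp add: sum.delta)
  also have "\<dots> = mat_word k X (i # w) $$ (s, t)"
    using mat_mult_entry[of "X i" k "mat_word k X w" s t] X mat_word_carrier[of X k w] Cons.prems(2) t
    by simp
  finally show ?case ..
qed

text \<open>
  The ring of \<open>k\<close> by \<open>k\<close> matrices satisfies, entry by entry, a nontrivial multilinear identity. For
  unknown coefficients \<open>c\<close> on the \<open>n!\<close> words, expand the entries over the \<open>(k\<^sup>2)\<^sup>n\<close> index
  assignments \<open>g\<close> and straighten each monomial. It suffices that for each \<open>g\<close> and each of the at most
  \<open>d\<^sup>n d\<^sup>n\<close> remaining words the total coefficient vanishes. For large \<open>n\<close> these linear equations are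
  fewer than the unknowns. Division by the gcd makes the coefficients jointly coprime, so that the
  identity does not become void when the additive group has torsion.
\<close>

lemma matrix_entry_identity:
  assumes PI: "PI_ring TYPE('a::{ring, monoid_mult})"
  shows "\<exists>n>0. \<forall>s<k. \<forall>t<k. \<exists>c :: nat list \<Rightarrow> int.
    Gcd (c ` permutations_of_set {..<n}) = 1 \<and>
    (\<forall>X :: nat \<Rightarrow> 'a mat. (\<forall>i. X i \<in> carrier_mat k k) \<longrightarrow>
      (\<Sum>w\<in>permutations_of_set {..<n}. int_scale (c w) (mat_word k X w $$ (s, t))) = 0)"
proof -
  obtain d b where lead: "b [0..<d] = 1" and id: "\<And>y :: nat \<Rightarrow> 'a.
      (\<Sum>h\<in>permutations_of_set {..<d}. int_scale (b h) (monomial y h)) = 0"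
    using PI_ring_multilinear_identity[OF PI] unfolding monomial_def by metis
  obtain n where n: "(k * k * (d * d)) ^ n < fact n"
    using exponential_less_fact by blast
  let ?S = "permutations_of_set {..<n}" and ?G = "good_words d n"
  let ?P = "{..<n} \<rightarrow>\<^sub>E {..<k} \<times> {..<k}"
  have "\<exists>a. \<forall>w\<in>?S. \<forall>r :: nat \<Rightarrow> 'a.
      monomial r w = (\<Sum>\<tau>\<in>?G. int_scale (a w \<tau>) (monomial r \<tau>))"
    using latyshev_straightening[of b d, OF lead id] by (intro bchoice) blast
  then obtain a where a: "\<And>w (r :: nat \<Rightarrow> 'a). w \<in> ?S \<Longrightarrow>
      monomial r w = (\<Sum>\<tau>\<in>?G. int_scale (a w \<tau>) (monomial r \<tau>))"
    by blast
  have card: "card (?P \<times> ?G) < card ?S"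
  proof -
    have "card (?P \<times> ?G) \<le> (k * k) ^ n * (d ^ n * d ^ n)"
      using card_good_words[of d n]
      by (simp add: card_cartesian_product card_funcsetE)
    also have "\<dots> = (k * k * (d * d)) ^ n" by (simp add: power_mult_distrib)
    also have "\<dots> < card ?S" using n by simp
    finally show ?thesis .
  qed
  have fin: "finite (?P \<times> ?G)" "finite ?S" by (auto intro!: finite_PiE)
  show ?thesis
  proof (intro exI[of _ n] conjI allI impI)
    show "n > 0" using n by (cases n) auto
  next
    fix s t assume st: "s < k" "t < k"
    \<comment> \<open>The coefficient with which word w contributes to the straightened word \<tau> for the assignment g.\<close>
    define M where "M w = (\<lambda>(g, \<tau>). of_bool (is_path s (map g w) t) * a w \<tau>)" for w
    obtain c where c: "\<exists>w\<in>?S. c w \<noteq> 0"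
      "\<And>x. x \<in> ?P \<times> ?G \<Longrightarrow> (\<Sum>w\<in>?S. c w * M w x) = 0"
      using integer_linear_dependence[OF fin card, of M] by blast
    define e where "e = Gcd (c ` ?S)"
    have e: "e \<noteq> 0" using c(1) by (auto simp: e_def)
    define c' where "c' w = c w div e" for w
    have c': "c w = e * c' w" if "w \<in> ?S" for w
      using that by (simp add: c'_def e_def)
    have "e = Gcd ((*) e ` c' ` ?S)"
      unfolding image_image e_def[THEN eq_reflection, symmetric]
      by (subst e_def) (intro arg_cong[of _ _ Gcd] image_cong refl c')
    also have "\<dots> = e * Gcd (c' ` ?S)"
      by (simp add: Gcd_mult e_def)
    finally have "Gcd (c' ` ?S) = 1" using e by simp
    moreover have "(\<Sum>w\<in>?S. int_scale (c' w) (mat_word k X w $$ (s, t))) = 0"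
      if X: "\<forall>i. X i \<in> carrier_mat k k" for X :: "nat \<Rightarrow> 'a mat"
    proof -
      let ?r = "\<lambda>g i. X i $$ g i"
      have "mat_word k X w $$ (s, t) = (\<Sum>x\<in>?P \<times> ?G. int_scale (M w x) (monomial (?r (fst x)) (snd x)))"
        if w: "w \<in> ?S" for w
      proof -
        have "set w = {..<n}" "distinct w" using w by (auto simp: permutations_of_set_def)
        then have "mat_word k X w $$ (s, t) =
            (\<Sum>g\<in>?P. int_scale (of_bool (is_path s (map g w) t)) (monomial (?r g) w))"
          using mat_word_entry[of X k w s t] X st by simp
        also have "\<dots> = (\<Sum>g\<in>?P. \<Sum>\<tau>\<in>?G. int_scale (M w (g, \<tau>)) (monomial (?r g) \<tau>))"
          by (intro sum.cong refl) (simp add: a[OF w] M_def int_scale.scale_sum_right)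
        finally show ?thesis by (simp add: sum.cartesian_product case_prod_unfold)
      qed
      then have "(\<Sum>w\<in>?S. int_scale (c' w) (mat_word k X w $$ (s, t))) =
          (\<Sum>w\<in>?S. \<Sum>x\<in>?P \<times> ?G. int_scale (c' w * M w x) (monomial (?r (fst x)) (snd x)))"
        by (intro sum.cong refl) (simp add: int_scale.scale_sum_right)
      also have "\<dots> = (\<Sum>x\<in>?P \<times> ?G. int_scale (\<Sum>w\<in>?S. c' w * M w x) (monomial (?r (fst x)) (snd x)))"
        by (subst sum.swap) (simp add: int_scale.scale_sum_left)
      also have "\<dots> = 0"
      proof (intro sum.neutral ballI)
        fix x assume x: "x \<in> ?P \<times> ?G"
        have "e * (\<Sum>w\<in>?S. c' w * M w x) = (\<Sum>w\<in>?S. c w * M w x)"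
          by (simp add: sum_distrib_left c' mult.assoc)
        then have "(\<Sum>w\<in>?S. c' w * M w x) = 0" using c(2)[OF x] e by simp
        then show "int_scale (\<Sum>w\<in>?S. c' w * M w x) (monomial (?r (fst x)) (snd x)) = 0"
          by (simp only: int_scale.scale_zero_left)
      qed
      finally show ?thesis .
    qed
    ultimately show "\<exists>c :: nat list \<Rightarrow> int. Gcd (c ` ?S) = 1 \<and>
      (\<forall>X :: nat \<Rightarrow> 'a mat. (\<forall>i. X i \<in> carrier_mat k k) \<longrightarrow>
        (\<Sum>w\<in>?S. int_scale (c w) (mat_word k X w $$ (s, t))) = 0)" by blast
  qed
qed

section \<open>Matrix units from a one-sided inverse\<close>

text \<open>
  If \<open>p a = 1\<close>, the idempotent \<open>e = 1 - a p\<close> satisfies \<open>p e = 0 = e a\<close>, and the elements \<open>a\<^sup>i e p\<^sup>j\<close>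
  multiply like matrix units of infinite size (Jacobson). The shift operators on sequences are the
  model case.
\<close>

locale one_sided_inverse = Ring.ring +
  fixes p a
  assumes p [simp, intro]: "p \<in> carrier R" and a [simp, intro]: "a \<in> carrier R"
    and pa: "p \<otimes> a = \<one>"
begin

definition defect where "defect = \<one> \<ominus> a \<otimes> p"

definition mat_unit :: "nat \<Rightarrow> nat \<Rightarrow> 'a" where
  "mat_unit i j = a [^] i \<otimes> (defect \<otimes> p [^] j)"

lemma defect_closed [simp, intro]: "defect \<in> carrier R"
  by (simp add: defect_def)

lemma mat_unit_closed [simp, intro]: "mat_unit i j \<in> carrier R"
  by (simp add: mat_unit_def)

lemma p_defect: "p \<otimes> defect = \<zero>"
proof -
  have "p \<otimes> (a \<otimes> p) = p" by (simp add: m_assoc[symmetric] pa)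
  then show ?thesis
    by (simp add: defect_def minus_eq r_distr r_minus r_neg)
qed

lemma defect_a: "defect \<otimes> a = \<zero>"
proof -
  have "(a \<otimes> p) \<otimes> a = a" by (simp add: m_assoc pa)
  then show ?thesis
    by (simp add: defect_def minus_eq l_distr l_minus r_neg)
qed

lemma defect_idem: "defect \<otimes> defect = defect"
proof -
  have "defect \<otimes> defect = defect \<ominus> (defect \<otimes> a) \<otimes> p"
    by (subst (2) defect_def) (simp add: minus_eq r_distr r_minus m_assoc)
  then show ?thesis by (simp add: defect_a minus_eq)
qed

lemma p_pow_a_pow: "p [^] n \<otimes> a [^] n = \<one>" for n :: nat
proof (induction n)
  case 0
  then show ?case by simp
next
  case (Suc n)
  have "p [^] Suc n \<otimes> a [^] Suc n = p [^] n \<otimes> ((p \<otimes> a) \<otimes> a [^] n)"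
    by (subst nat_pow_Suc2[OF a]) (simp add: m_assoc)
  then show ?case by (simp add: pa Suc)
qed

lemma defect_p_pow_a_pow_defect:
  "defect \<otimes> p [^] j \<otimes> (a [^] l \<otimes> defect) = (if j = l then defect else \<zero>)" for j l :: nat
proof (cases j l rule: linorder_cases)
  case less
  then obtain m where l: "l = j + Suc m" using less_imp_Suc_add by auto
  have "defect \<otimes> p [^] j \<otimes> (a [^] l \<otimes> defect)
      = defect \<otimes> (p [^] j \<otimes> a [^] j) \<otimes> (a \<otimes> a [^] m \<otimes> defect)"
    by (simp only: l nat_pow_mult[OF a, symmetric] nat_pow_Suc2[OF a] m_assoc p a
        nat_pow_closed m_closed defect_closed)
  also have "\<dots> = defect \<otimes> a \<otimes> (a [^] m \<otimes> defect)"
    by (simp add: p_pow_a_pow m_assoc)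
  finally show ?thesis using less by (simp add: defect_a)
next
  case equal
  have "defect \<otimes> p [^] j \<otimes> (a [^] j \<otimes> defect) = defect \<otimes> (p [^] j \<otimes> a [^] j) \<otimes> defect"
    by (simp add: m_assoc)
  with equal show ?thesis by (simp add: p_pow_a_pow defect_idem)
next
  case greater
  then obtain m where j: "j = Suc m + l" using less_imp_Suc_add by (metis add.commute add_Suc_right)
  have "defect \<otimes> p [^] j \<otimes> (a [^] l \<otimes> defect)
      = defect \<otimes> p [^] m \<otimes> (p \<otimes> ((p [^] l \<otimes> a [^] l) \<otimes> defect))"
    by (simp only: j nat_pow_mult[OF p, symmetric] nat_pow_Suc m_assoc p a
        nat_pow_closed m_closed defect_closed)
  also have "\<dots> = \<zero>" by (simp add: p_pow_a_pow p_defect)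
  finally show ?thesis using greater by simp
qed

lemma mat_unit_mult:
  "mat_unit i j \<otimes> mat_unit l m = (if j = l then mat_unit i m else \<zero>)"
proof -
  have "mat_unit i j \<otimes> mat_unit l m
      = a [^] i \<otimes> (defect \<otimes> p [^] j \<otimes> (a [^] l \<otimes> defect)) \<otimes> p [^] m"
    by (simp add: mat_unit_def m_assoc)
  then show ?thesis
    unfolding defect_p_pow_a_pow_defect by (simp add: mat_unit_def m_assoc)
qed

text \<open>
  Multiplication by \<open>p\<^sup>i\<close> from the left and by \<open>a\<^sup>j\<close> from the right recovers the defect.
\<close>

lemma mat_unit_zero_imp_inverse:
  assumes "mat_unit i j = \<zero>"
  shows "a \<otimes> p = \<one>"
proof -
  have "p [^] i \<otimes> mat_unit i j \<otimes> a [^] j = (p [^] i \<otimes> a [^] i) \<otimes> defect \<otimes> (p [^] j \<otimes> a [^] j)"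
    by (simp add: mat_unit_def m_assoc)
  then have "defect = \<zero>" using assms by (simp add: p_pow_a_pow)
  moreover have "defect \<oplus> a \<otimes> p = \<one>"
    by (simp add: defect_def minus_eq a_assoc l_neg)
  ultimately show ?thesis by simp
qed

text \<open>
  With \<open>e\<^bsub>i,j\<^esub> = a\<^sup>i e p\<^sup>j\<close>, a product of factors \<open>e\<^bsub>i,i+1\<^esub>\<close> survives only if the indices \<open>i\<close> are consecutive.
\<close>

lemma staircase_product:
  assumes "w \<noteq> []"
  shows "foldr (\<lambda>i M. mat_unit i (Suc i) \<otimes> M) w \<one> =
    (if w = [hd w..<hd w + length w] then mat_unit (hd w) (hd w + length w) else \<zero>)"
  using assms
proof (induction w)
  case Nil
  then show ?case by simp
next
  case (Cons i w)
  show ?case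
  proof (cases "w = []")
    case True
    then show ?thesis by simp
  next
    case False
    have "[i..<i + Suc (length w)] = i # [Suc i..<Suc i + length w]"
      using upt_conv_Cons[of i "i + Suc (length w)"] by (simp del: upt_Suc)
    moreover have "hd w = Suc i" if "w = [Suc i..<Suc i + length w]"
      using False hd_upt[of "Suc i" "Suc i + length w"] that by (metis length_greater_0_conv less_add_same_cancel1)
    ultimately have word: "i # w = [hd (i # w)..<hd (i # w) + length (i # w)]
        \<longleftrightarrow> hd w = Suc i \<and> w = [hd w..<hd w + length w]"
      by auto
    define b where "b \<longleftrightarrow> w = [hd w..<hd w + length w]"
    have "foldr (\<lambda>i M. mat_unit i (Suc i) \<otimes> M) w \<one> =
        (if b then mat_unit (hd w) (hd w + length w) else \<zero>)"
      using Cons.IH[OF False] by (simp only: b_def)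
    then show ?thesis
      unfolding word b_def[symmetric] by (cases b) (auto simp: mat_unit_mult)
  qed
qed

lemma staircase_product_permutation:
  assumes w: "set w = {..<n}" "length w = n" and "n > 0"
  shows "foldr (\<lambda>i M. mat_unit i (Suc i) \<otimes> M) w \<one> =
    (if w = [0..<n] then mat_unit 0 n else \<zero>)"
proof -
  have ne: "w \<noteq> []" using w(2) assms(3) by auto
  have hd0: "hd w = 0" if "w = [hd w..<hd w + n]"
  proof -
    have "0 \<in> set w" using w(1) assms(3) by simp
    then have "0 \<in> set [hd w..<hd w + n]" using that by (rule subst[rotated])
    then show ?thesis by simp
  qed
  show ?thesis
  proof (cases "w = [0..<n]")
    case True
    then show ?thesis using staircase_product[OF ne] assms(3) by (simp add: hd_upt)
  next
    case False
    then have "w \<noteq> [hd w..<hd w + n]" using hd0 by (metis add_0)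
    with False show ?thesis using staircase_product[OF ne] w(2) by simp
  qed
qed

end

section \<open>Direct finiteness of matrix rings\<close>

lemma matrix_ring_simps [simp]:
  "carrier (matrix_ring k) = carrier_mat k k" "mult (matrix_ring k) = (*)"
  "one (matrix_ring k) = 1\<^sub>m k" "zero (matrix_ring k) = 0\<^sub>m k k"
  by (simp_all add: matrix_ring_def)

text \<open>
  Substitute the matrix units \<open>e\<^bsub>i,i+1\<^esub>\<close> for the variables of the identity of
  \<open>matrix_entry_identity\<close>, numbered along a chosen word \<open>v\<close>. Every word other than \<open>v\<close>
  evaluates to \<open>0\<close>, so the coefficient of \<open>v\<close> annihilates the entries of \<open>e\<^bsub>0,n\<^esub>\<close>. This holds for each
  \<open>v\<close>, and the coefficients are jointly coprime, so \<open>e\<^bsub>0,n\<^esub> = 0\<close> and the defect \<open>1 - Q P\<close> vanishes.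
\<close>

lemma matrix_ring_directly_finite:
  fixes P Q :: "'a::{ring, monoid_mult} mat"
  assumes PI: "PI_ring TYPE('a)"
    and P: "P \<in> carrier_mat k k" and Q: "Q \<in> carrier_mat k k" and PQ: "P * Q = 1\<^sub>m k"
  shows "Q * P = 1\<^sub>m k"
proof -
  interpret one_sided_inverse "matrix_ring k :: 'a mat ring" P Q
    using ring_matrix_ring P Q PQ
    by (simp add: one_sided_inverse_def one_sided_inverse_axioms_def)
  obtain n where n: "n > 0" and id: "\<forall>s<k. \<forall>t<k. \<exists>c :: nat list \<Rightarrow> int.
      Gcd (c ` permutations_of_set {..<n}) = 1 \<and>
      (\<forall>X :: nat \<Rightarrow> 'a mat. (\<forall>i. X i \<in> carrier_mat k k) \<longrightarrow>
        (\<Sum>w\<in>permutations_of_set {..<n}. int_scale (c w) (mat_word k X w $$ (s, t))) = 0)"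
    using matrix_entry_identity[OF PI, of k] by blast
  let ?S = "permutations_of_set {..<n}"
  have unit_carrier: "mat_unit i j \<in> carrier_mat k k" for i j
    using mat_unit_closed[of i j] by simp
  have "mat_unit 0 n $$ (s, t) = 0" if st: "s < k" "t < k" for s t
  proof -
    obtain c where gcd: "Gcd (c ` ?S) = 1" and c: "\<And>X :: nat \<Rightarrow> 'a mat.
        (\<And>i. X i \<in> carrier_mat k k) \<Longrightarrow>
        (\<Sum>w\<in>?S. int_scale (c w) (mat_word k X w $$ (s, t))) = 0"
      using id st by blast
    have "int_scale (c v) (mat_unit 0 n $$ (s, t)) = 0" if v: "v \<in> ?S" for v
    proof -
      have v': "set v = {..<n}" "distinct v" "length v = n"
        using v length_finite_permutations_of_set[OF v] by (auto simp: permutations_of_set_def)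
      \<comment> \<open>The position of a letter in v.\<close>
      define f where "f = inv_into {..<n} ((!) v)"
      define X where "X x = mat_unit (f x) (Suc (f x))" for x
      have bij: "bij_betw ((!) v) {..<n} {..<n}"
        by (rule bij_betw_nth[OF v'(2)]) (simp_all add: v')
      then have f: "bij_betw f {..<n} {..<n}"
        unfolding f_def by (rule bij_betw_inv_into)
      have f_nth: "f (v ! i) = i" if "i < n" for i
        unfolding f_def using bij_betw_inv_into_left[OF bij, of i] that by simp
      have word: "mat_word k X w = (if w = v then mat_unit 0 n else 0\<^sub>m k k)" if w: "w \<in> ?S" for w
      proof -
        have w': "set w = {..<n}" "distinct w" "length w = n"
          using w length_finite_permutations_of_set[OF w] by (auto simp: permutations_of_set_def)
        have word: "mat_word k X w = foldr (\<lambda>i M. mat_unit i (Suc i) * M) (map f w) (1\<^sub>m k)"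
          unfolding mat_word_def by (simp add: foldr_map comp_def X_def)
        have fw: "set (map f w) = {..<n}" "length (map f w) = n"
          using f w' by (simp_all add: bij_betw_def)
        have "map f v = [0..<n]"
          using f_nth v'(3) by (intro nth_equalityI) simp_all
        moreover have "inj_on (map f) (lists {..<n})"
          using f by (intro inj_on_mapI inj_on_subset[OF bij_betw_imp_inj_on[OF f]]) auto
        ultimately have "map f w = [0..<n] \<longleftrightarrow> w = v"
          using w'(1) v'(1) by (metis inj_onD in_listsI lessThan_iff)
        then show ?thesis
          using staircase_product_permutation[OF fw n] unfolding word by simp
      qed
      have X: "X i \<in> carrier_mat k k" for i
        using unit_carrier by (simp add: X_def)
      have "(\<Sum>w\<in>?S. int_scale (c w) (mat_word k X w $$ (s, t)))
          = (\<Sum>w\<in>?S. if w = v then int_scale (c v) (mat_unit 0 n $$ (s, t)) else 0)"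
        using st by (intro sum.cong refl) (simp add: word)
      also have "\<dots> = int_scale (c v) (mat_unit 0 n $$ (s, t))"
        using v by (simp add: sum.delta)
      finally show ?thesis using c[of X, OF X] by simp
    qed
    then have "int_scale (Gcd (c ` ?S)) (mat_unit 0 n $$ (s, t)) = 0"
      by (intro annihilated_by_Gcd) auto
    then show ?thesis by (simp add: gcd int_scale_one)
  qed
  then have "mat_unit 0 n = 0\<^sub>m k k"
    using unit_carrier[of 0 n] by (intro eq_matI) auto
  then show ?thesis using mat_unit_zero_imp_inverse[of 0 n] by simp
qed

text \<open>
  Order the indices so that those in \<open>J\<close> come first. Then \<open>A\<close> is block upper triangular with upper left
  block \<open>A\<^sub>1\<close>. If \<open>B\<^sub>1\<close> and \<open>B\<^sub>2\<close> are the upper and lower left blocks of \<open>B\<close>, then \<open>B A = 1\<close> gives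
  \<open>B\<^sub>1 A\<^sub>1 = 1\<close> and \<open>B\<^sub>2 A\<^sub>1 = 0\<close>. Direct finiteness turns the former into \<open>A\<^sub>1 B\<^sub>1 = 1\<close>, whence
  \<open>B\<^sub>2 = B\<^sub>2 A\<^sub>1 B\<^sub>1 = 0\<close>.
\<close>

lemma inverse_vanishes_off_diagonal_block:
  fixes A B :: "'a::{ring, monoid_mult} mat"
  assumes PI: "PI_ring TYPE('a)"
    and A: "A \<in> carrier_mat n n" and B: "B \<in> carrier_mat n n" and BA: "B * A = 1\<^sub>m n"
    and J: "J \<subseteq> {..<n}"
    and zero: "\<And>x y. x \<in> {..<n} - J \<Longrightarrow> y \<in> J \<Longrightarrow> A $$ (x, y) = 0"
    and i: "i \<in> {..<n} - J" and j: "j \<in> J"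
  shows "B $$ (i, j) = 0"
proof -
  \<comment> \<open>Extension of the J-block by the identity keeps the matrix size n, so that no reindexing is needed.\<close>
  define ext where "ext M = mat n n (\<lambda>(x, y). if x \<in> J \<and> y \<in> J then M $$ (x, y) else (if x = y then 1 else 0))"
    for M :: "'a mat"
  have finJ: "finite J" using J finite_subset by auto
  have ext_carrier: "ext M \<in> carrier_mat n n" for M by (simp add: ext_def)
  have ext_entry: "ext M $$ (x, y) = (if x \<in> J \<and> y \<in> J then M $$ (x, y) else (if x = y then 1 else 0))"
    if "x < n" "y < n" for M x y
    using that by (simp add: ext_def)
  have restrict: "(\<Sum>z<n. g z) = (\<Sum>z\<in>J. g z)" if "\<And>z. z \<in> {..<n} - J \<Longrightarrow> g z = 0" for g :: "nat \<Rightarrow> 'a"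
    using that J by (intro sum.mono_neutral_right) auto
  have BA_J: "(\<Sum>z\<in>J. B $$ (x, z) * A $$ (z, y)) = (if x = y then 1 else 0)" if "x < n" "y \<in> J" for x y
  proof -
    have "(\<Sum>z\<in>J. B $$ (x, z) * A $$ (z, y)) = (B * A) $$ (x, y)"
      using that J zero by (subst mat_mult_entry[OF B A]) (auto intro!: restrict[symmetric])
    then show ?thesis using that J unfolding BA by (auto simp: one_mat_def)
  qed
  have ext_mult: "(ext M * ext N) $$ (x, y) =
      (if x \<in> J \<and> y \<in> J then \<Sum>z\<in>J. M $$ (x, z) * N $$ (z, y) else (if x = y then 1 else 0))"
    if "x < n" "y < n" for M N x y
  proof (cases "x \<in> J")
    case True
    have "(ext M * ext N) $$ (x, y) = (\<Sum>z\<in>J. ext M $$ (x, z) * ext N $$ (z, y))"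
      unfolding mat_mult_entry[OF ext_carrier ext_carrier that]
      by (rule restrict) (use that True in \<open>auto simp: ext_entry\<close>)
    also have "\<dots> = (\<Sum>z\<in>J. M $$ (x, z) * (if y \<in> J then N $$ (z, y) else 0))"
      using that True J by (intro sum.cong refl) (auto simp: ext_entry subset_eq)
    finally show ?thesis using True by auto
  next
    case False
    have "(ext M * ext N) $$ (x, y) = (\<Sum>z<n. if z = x then ext N $$ (z, y) else 0)"
      unfolding mat_mult_entry[OF ext_carrier ext_carrier that]
      by (rule sum.cong) (use that False in \<open>auto simp: ext_entry\<close>)
    also have "\<dots> = (if x = y then 1 else 0)" using that False by (simp add: sum.delta ext_entry)
    finally show ?thesis using False by simp
  qed
  have "ext B * ext A = 1\<^sub>m n"
    using J by (intro eq_matI)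
      (auto simp: ext_mult BA_J carrier_matD[OF ext_carrier] simp del: index_mult_mat(1))
  then have "ext A * ext B = 1\<^sub>m n"
    by (rule matrix_ring_directly_finite[OF PI ext_carrier ext_carrier])
  then have AB_J: "(\<Sum>z\<in>J. A $$ (x, z) * B $$ (z, j)) = (if x = j then 1 else 0)" if "x \<in> J" for x
    using ext_mult[of x j A B] that j J by (auto simp: subset_eq)
  have "B $$ (i, j) = (\<Sum>x\<in>J. B $$ (i, x) * (if x = j then 1 else 0))"
    using j finJ by (simp add: if_distrib sum.delta cong: if_cong)
  also have "\<dots> = (\<Sum>x\<in>J. \<Sum>z\<in>J. B $$ (i, x) * (A $$ (x, z) * B $$ (z, j)))"
    by (intro sum.cong refl) (simp add: AB_J[symmetric] sum_distrib_left)
  also have "\<dots> = (\<Sum>z\<in>J. (\<Sum>x\<in>J. B $$ (i, x) * A $$ (x, z)) * B $$ (z, j))"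
    by (subst sum.swap) (simp add: sum_distrib_right mult.assoc)
  also have "\<dots> = 0"
    using BA_J[of i] i by (intro sum.neutral) auto
  finally show ?thesis .
qed

section \<open>Inverses of structural matrices\<close>

theorem corollary3p5:
  fixes n :: nat and \<theta> :: "(nat \<times> nat) set"
    and A :: "'a::{ring, monoid_mult} mat"
  assumes "n \<ge> 1"
    and "\<theta> \<subseteq> {1..n} \<times> {1..n}" and "refl_on {1..n} \<theta>" and "trans \<theta>"
    and "PI_ring TYPE('a)"
    and "A \<in> structural_matrices n \<theta>"
    and "A \<in> Units (matrix_ring n)"
  shows "inv\<^bsub>matrix_ring n\<^esub> A \<in> structural_matrices n \<theta>"
proof -
  interpret Ring.ring "matrix_ring n :: 'a mat ring" by (rule ring_matrix_ring)
  let ?B = "inv\<^bsub>matrix_ring n\<^esub> A"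
  have A: "A \<in> carrier_mat n n" using assms(6) by (simp add: structural_matrices_def)
  have B: "?B \<in> carrier_mat n n" and BA: "?B * A = 1\<^sub>m n"
    using Units_inv_closed[OF assms(7)] Units_l_inv[OF assms(7)] by simp_all
  have "?B $$ (i - 1, j - 1) = 0" if ij: "i \<in> {1..n}" "j \<in> {1..n}" "(i, j) \<notin> \<theta>" for i j
  proof (rule inverse_vanishes_off_diagonal_block[OF assms(5) A B BA])
    \<comment> \<open>Matrix indices start at 0, those of the relation at 1.\<close>
    let ?J = "{y. y < n \<and> (Suc y, j) \<in> \<theta>}"
    show "?J \<subseteq> {..<n}" by auto
    show "i - 1 \<in> {..<n} - ?J" using ij by auto
    show "j - 1 \<in> ?J" using ij refl_onD[OF assms(3) ij(2)] by auto
    fix x y assume x: "x \<in> {..<n} - ?J" and y: "y \<in> ?J"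
    then have "(Suc x, Suc y) \<notin> \<theta>" using transD[OF assms(4)] by auto
    moreover have "Suc x \<in> {1..n}" "Suc y \<in> {1..n}" using x y by auto
    ultimately show "A $$ (x, y) = 0"
      using assms(6) unfolding structural_matrices_def by force
  qed
  with B show ?thesis by (simp add: structural_matrices_def)
qed

end
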